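(* Let $q$ be a prime power with $p=\mathrm{char}\,\mathbb F_q$, and assume that $f\in\mathcal B_q$ permutes $\mathbb F_q$. Then there is a unique triple $(d,n,a)$, where $d\mid q-1$, $n\in N_d$ and $a\in A_{d,n}$, such that $f(X)\sim X^n(X^d+a)$.
   Context: $\mathcal B_q$ is the set of binomials $f(X)=\alpha X^m+\beta X^k\in\mathbb F_q[X]$ with $\alpha,\beta\in\mathbb F_q^*$, $m,k>0$, $m\not\equiv 0$, $k\not\equiv 0$, $m\not\equiv k\pmod{q-1}$, each regarded as a function $\mathbb F_q\to\mathbb F_q$ (i.e. identified with its image in $\mathbb F_q[X]/\langle X^q-X\rangle$). For $f,g\in\mathcal B_q$, $f\sim g$ (equivalence) means $g(X)=u\,f(vX^s)^{p^i}$ (as functions on $\mathbb F_q$) for some $u,v\in\mathbb F_q^*$, integer $i\ge 0$ and integer $s>0$ with $\gcd(s,q-1)=1$; equivalently, $\sim$ is the equivalence generated by $f\mapsto uf$, $f\mapsto f^p$, $f\mapsto f(vX^s)$. For $d\mid q-1$ and $1\le n\le q-1$, let $n^*$ be the least $n'\in\{1,\dots,q-1\}$ such that either $n'\equiv tn\pmod{q-1}$ for some $t\in(\mathbb Z/(q-1)\mathbb Z)^\times$ with $t\equiv 1\pmod{(q-1)/d}$, or $n'\equiv tn-d\pmod{q-1}$ for some $t\in(\mathbb Z/(q-1)\mathbb Z)^\times$ with $t\equiv -1\pmod{(q-1)/d}$. Set $N_d=\{1\le n\le q-1: n=n^*\}$. For $d\mid q-1$ and $n\in N_d$, let $G_{d,n}$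 be the subgroup of $(\mathbb Z/d\mathbb Z)^\times$ generated by $\{p,-1\}$ if $d\equiv -2n\pmod{(q-1)/d}$ and $\gcd(n,q-1)=1$, and generated by $\{p\}$ otherwise. Let $G_{d,n}$ act on $\mathbb F_q^*/(\mathbb F_q^* )^d$ (where $(\mathbb F_q^* )^d=\{x^d:x\in\mathbb F_q^*\}$) by $s\cdot a(\mathbb F_q^* )^d=a^s(\mathbb F_q^* )^d$. $A_{d,n}\subset\mathbb F_q^*$ is a fixed set such that $\{a(\mathbb F_q^* )^d: a\in A_{d,n}\}$ is a system of representatives of the $G_{d,n}$-orbits in $\mathbb F_q^*/(\mathbb F_q^* )^d$. *)

theory Defs
  imports
    "HOL-Algebra.Group_Action"
    "HOL-Algebra.Generated_Groups"
    "HOL-Library.Cardinality"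
    "HOL-Number_Theory.Cong"
    "HOL-Computational_Algebra.Primes"
begin

text \<open>Binomials are identified with the functions they induce on the finite field \<open>'a\<close>,
  i.e. polynomials are read modulo \<open>X^q - X\<close> with \<open>q = CARD('a)\<close>.\<close>

definition binomials :: "('a::finite_field \<Rightarrow> 'a) set" where
  "binomials = {(\<lambda>x. \<alpha> * x ^ m + \<beta> * x ^ k) | \<alpha> \<beta> m k.
     \<alpha> \<noteq> 0 \<and> \<beta> \<noteq> 0 \<and> m > 0 \<and> k > 0 \<and>
     \<not> [m = 0] (mod (CARD('a) - 1)) \<and>
     \<not> [k = 0] (mod (CARD('a) - 1)) \<and>
     \<not> [m = k] (mod (CARD('a) - 1))}"

definition binom_equiv :: "('a::finite_field \<Rightarrow> 'a) \<Rightarrow> ('a \<Rightarrow> 'a) \<Rightarrow> bool"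
    (infix \<open>\<sim>\<^sub>b\<close> 50) where
  "f \<sim>\<^sub>b g \<longleftrightarrow> f \<in> binomials \<and> g \<in> binomials \<and>
     (\<exists>u v i s. u \<noteq> 0 \<and> v \<noteq> 0 \<and> s > 0 \<and> gcd s (CARD('a) - 1) = 1 \<and>
        g = (\<lambda>x. u * f (v * x ^ s) ^ (CHAR('a) ^ i)))"

text \<open>Units modulo \<open>q - 1\<close> are represented by integers \<open>t\<close> coprime to \<open>q - 1\<close>.\<close>

definition nstar :: "nat \<Rightarrow> nat \<Rightarrow> nat \<Rightarrow> nat" where
  "nstar q d n = (LEAST n'. n' \<in> {1..q - 1} \<and>
     ((\<exists>t::int. coprime t (int (q - 1)) \<and> [t = 1] (mod int ((q - 1) div d)) \<and>
         [int n' = t * int n] (mod int (q - 1))) \<or>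
      (\<exists>t::int. coprime t (int (q - 1)) \<and> [t = - 1] (mod int ((q - 1) div d)) \<and>
         [int n' = t * int n - int d] (mod int (q - 1)))))"

definition N_set :: "nat \<Rightarrow> nat \<Rightarrow> nat set" where
  "N_set q d = {n \<in> {1..q - 1}. n = nstar q d n}"

text \<open>The group of units of \<open>\<int>/d\<int>\<close> on least nonnegative residues. The neutral element is
  \<open>1 mod d\<close> so that the case \<open>d = 1\<close> (trivial group with carrier \<open>{0}\<close>) is covered, which it is
  not by the unit group of the library's \<open>residue_ring\<close>.\<close>

definition units_mod :: "nat \<Rightarrow> int monoid" where
  "units_mod d = \<lparr>carrier = {x. 0 \<le> x \<and> x < int d \<and> coprime x (int d)},
     monoid.mult = (\<lambda>x y. (x * y) mod int d), one = 1 mod int d\<rparr>"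

definition G_grp :: "nat \<Rightarrow> nat \<Rightarrow> nat \<Rightarrow> nat \<Rightarrow> int monoid" where
  "G_grp p q d n = units_mod d \<lparr>carrier := generate (units_mod d)
     (if [int d = - 2 * int n] (mod int ((q - 1) div d)) \<and> gcd n (q - 1) = 1
      then {int p mod int d, (- 1) mod int d} else {int p mod int d})\<rparr>"

definition field_units :: "'a::field monoid" where
  "field_units = \<lparr>carrier = UNIV - {0}, monoid.mult = (*), one = 1\<rparr>"

definition powers :: "nat \<Rightarrow> 'a::field set" where
  "powers d = {x ^ d | x. x \<noteq> 0}"

definition pow_coset :: "nat \<Rightarrow> 'a::field \<Rightarrow> 'a set" where
  "pow_coset d a = powers d #>\<^bsub>field_units\<^esub> a"

text \<open>The action \<open>s \<cdot> a(F\<^sup>*)\<^sup>d = a\<^sup>s(F\<^sup>*)\<^sup>d\<close>; the union runs over all representatives \<open>a\<close> of the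
  coset \<open>C\<close>, which all contribute the same coset (see \<open>coset_act_pow_coset\<close>).\<close>

definition coset_act :: "nat \<Rightarrow> int \<Rightarrow> 'a::field set \<Rightarrow> 'a set" where
  "coset_act d s = (\<lambda>C \<in> carrier (field_units Mod powers d). \<Union>a\<in>C. pow_coset d (a ^ nat s))"

text \<open>Distinct elements of \<open>A\<close> are required to lie in distinct cosets, so that every orbit is
  represented by exactly one element of \<open>A\<close>.\<close>

definition orbit_reps :: "nat \<Rightarrow> nat \<Rightarrow> 'a::finite_field set \<Rightarrow> bool" where
  "orbit_reps d n A \<longleftrightarrow> A \<subseteq> UNIV - {0} \<and> inj_on (pow_coset d) A \<and>
     (\<forall>Orb \<in> orbits (G_grp CHAR('a) CARD('a) d n) (carrier (field_units Mod powers d)) (coset_act d).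
        \<exists>!C. C \<in> pow_coset d ` A \<and> C \<in> Orb)"

lemma pow_coset_eq: "pow_coset d a = {a * x ^ d | x. x \<noteq> 0}"
  by (auto simp: pow_coset_def powers_def r_coset_def field_units_def mult.commute)

lemma coset_act_pow_coset:
  fixes a :: "'a::field"
  assumes "a \<noteq> 0"
  shows "coset_act d s (pow_coset d a) = pow_coset d (a ^ nat s)"
proof -
  have "pow_coset d a \<in> carrier (field_units Mod powers d)"
    using assms by (auto simp: carrier_FactGroup pow_coset_def field_units_def)
  moreover have "pow_coset d (b ^ nat s) = pow_coset d (a ^ nat s)" if "b \<in> pow_coset d a" for b
  proof -
    obtain x where x: "x \<noteq> 0" "b = a * x ^ d"
      using \<open>b \<in> pow_coset d a\<close> by (auto simp: pow_coset_eq)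
    have b: "b ^ nat s = a ^ nat s * (x ^ nat s) ^ d"
      by (simp add: x power_mult_distrib power_mult[symmetric] mult.commute)
    show ?thesis
    proof (intro Set.set_eqI iffI)
      fix y assume "y \<in> pow_coset d (b ^ nat s)"
      then obtain z where "z \<noteq> 0" "y = b ^ nat s * z ^ d" by (auto simp: pow_coset_eq)
      then have "y = a ^ nat s * (x ^ nat s * z) ^ d" "x ^ nat s * z \<noteq> 0"
        using x(1) by (simp_all add: b power_mult_distrib)
      then show "y \<in> pow_coset d (a ^ nat s)" unfolding pow_coset_eq by blast
    next
      fix y assume "y \<in> pow_coset d (a ^ nat s)"
      then obtain z where "z \<noteq> 0" "y = a ^ nat s * z ^ d" by (auto simp: pow_coset_eq)
      then have "y = b ^ nat s * (z / x ^ nat s) ^ d" "z / x ^ nat s \<noteq> 0"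
        using x(1) by (simp_all add: b power_divide)
      then show "y \<in> pow_coset d (b ^ nat s)" unfolding pow_coset_eq by blast
    qed
  qed
  moreover have "a \<in> pow_coset d a"
    by (auto simp: pow_coset_eq intro!: exI[of _ 1])
  ultimately have "pow_coset d a \<in> carrier (field_units Mod powers d)"
    and "(\<Union>b\<in>pow_coset d a. pow_coset d (b ^ nat s)) = pow_coset d (a ^ nat s)"
    by blast+
  then show ?thesis
    by (simp only: coset_act_def restrict_apply if_True)
qed

lemma group_units_mod:
  assumes "d > 0"
  shows "group (units_mod d)"
proof (rule groupI)
  fix x assume x: "x \<in> carrier (units_mod d)"
  then obtain y where "[x * y = 1] (mod int d)"
    using cong_solve_coprime_int[of x "int d"] by (auto simp: units_mod_def)
  then have xy: "(y mod int d * x) mod int d = 1 mod int d"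
    by (simp add: cong_def mod_mult_right_eq mult.commute)
  then have "[y mod int d * x = 1] (mod int d)" by (simp add: cong_def)
  then have "coprime (y mod int d) (int d)"
    using coprime_iff_invertible_int by blast
  then have "y mod int d \<in> carrier (units_mod d)"
    using assms by (simp add: units_mod_def)
  then show "\<exists>y\<in>carrier (units_mod d). y \<otimes>\<^bsub>units_mod d\<^esub> x = \<one>\<^bsub>units_mod d\<^esub>"
    using xy by (auto simp: units_mod_def)
qed (use assms in \<open>auto simp: units_mod_def mod_mult_left_eq mod_mult_right_eq mult.assoc
       mod_pos_pos_trivial\<close>)

end

theory Submission
  imports
    Defs
    "HOL-Computational_Algebra.Polynomial"
    "HOL-Number_Theory.Residues"
begin

text \<open>Put \<open>Q = q - 1\<close>. A function given by a binomial determines its two coefficients and its two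
  exponents modulo \<open>Q\<close>, and a transformation \<open>u f(vX\<^sup>s)^(p^i)\<close> multiplies both exponents by the
  unit \<open>t = s p\<^sup>i\<close>. Multiplying the difference of the exponents by a unit turns it into its gcd \<open>d\<close>
  with \<open>Q\<close>, which is therefore an invariant. The units preserving the difference up to sign are those
  with \<open>t \<equiv> \<plusminus>1\<close> modulo \<open>Q / d\<close>, and they move \<open>n\<close> exactly within the class whose least element is
  \<open>n\<^sup>*\<close>. With \<open>d\<close> and \<open>n\<close> fixed, the coefficient \<open>a\<close> may change by \<open>d\<close>-th powers, by Frobenius, and
  into its inverse precisely when a unit exchanges \<open>n\<close> and \<open>n + d\<close>; since \<open>n\<close>, \<open>d\<close>, \<open>Q\<close> have no common
  divisor for a permutation, this happens iff \<open>d \<equiv> -2n\<close> modulo \<open>Q / d\<close> and \<open>n\<close> is coprime to \<open>Q\<close>.\<close>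

subsection \<open>Power functions and binomials on a finite field\<close>

lemma card_field_gt_1: "CARD('a::finite_field) > 1"
proof -
  have "card {0, 1 :: 'a} \<le> CARD('a)" by (intro card_mono) auto
  then show ?thesis by simp
qed

text \<open>Since x^q = x, powers repeat with period q - 1. Positivity of the exponents matters at x
  = 0, where x^0 = 1.\<close>

lemma field_power_cong:
  fixes x :: "'a::finite_field"
  assumes "[m = n] (mod CARD('a) - 1)" "m > 0" "n > 0"
  shows "x ^ m = x ^ n"
proof -
  define Q where "Q = CARD('a) - 1"
  have Q: "CARD('a) = Q + 1" using card_field_gt_1[where 'a='a] by (simp add: Q_def)
  have step: "x ^ (j + Q * l) = x ^ j" if jpos: "j > 0" for j l
  proof (induction l)
    case (Suc l)
    \<comment> \<open>One factor x is split off so that x^Q * x = x^q becomes x without a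
      division.\<close>
    obtain j' where j': "j = Suc j'" using gr0_implies_Suc[OF jpos] by blast
    have "x ^ (j + Q * Suc l) = x ^ (j' + Q * l) * x ^ CARD('a)"
      unfolding power_add[symmetric] Q j' by (simp add: algebra_simps)
    also have "\<dots> = x ^ (j + Q * l)"
      by (simp add: j' finite_field_power_card_eq_same)
    finally show ?case using Suc by simp
  qed simp
  obtain j l where "m + Q * j = n + Q * l"
    using assms(1) unfolding cong_iff_lin_nat Q_def[symmetric] by (metis mult.commute)
  then show ?thesis using step[of m j] step[of n l] assms by metis
qed

lemma field_power_cong_int:
  fixes x :: "'a::finite_field"
  assumes "[int m = int n] (mod int (CARD('a) - 1))" "m > 0" "n > 0"
  shows "x ^ m = x ^ n"
  using assms field_power_cong by (metis cong_int_iff)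

text \<open>Modulo \<open>X\<^sup>q - X\<close> every exponent reduces into \<open>{1..q - 1}\<close>, and a polynomial of degree
  less than \<open>q\<close> is determined by its values.\<close>

lemma binomial_fun_coeffs:
  fixes \<alpha> \<beta> \<alpha>' \<beta>' :: "'a::finite_field"
  assumes eq: "\<And>x. \<alpha> * x ^ m + \<beta> * x ^ k = \<alpha>' * x ^ m' + \<beta>' * x ^ k'"
    and pos: "m > 0" "k > 0" "m' > 0" "k' > 0"
  shows "(if [m = i] (mod CARD('a) - 1) then \<alpha> else 0) + (if [k = i] (mod CARD('a) - 1) then \<beta> else 0)
       = (if [m' = i] (mod CARD('a) - 1) then \<alpha>' else 0) + (if [k' = i] (mod CARD('a) - 1) then \<beta>' else 0)"
proof -
  define Q where "Q = CARD('a) - 1"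
  have Q: "Q > 0" using card_field_gt_1[where 'a='a] by (simp add: Q_def)
  \<comment> \<open>The class of 0 is represented by \<open>Q\<close>, since x^Q and x^0 differ at x
    = 0.\<close>
  define r where "r j = (if Q dvd j then Q else j mod Q)" for j
  have r_cong: "[r j = j] (mod Q)" for j by (auto simp: r_def cong_def)
  have r_pos: "r j > 0" for j using Q by (auto simp: r_def dvd_eq_mod_eq_0)
  have r_le: "r j \<le> Q" for j using Q by (auto simp: r_def less_imp_le)
  have r_eq: "r j = r l \<longleftrightarrow> [j = l] (mod Q)" for j l
  proof
    assume "r j = r l" then show "[j = l] (mod Q)"
      using r_cong by (metis cong_sym cong_trans)
  next
    assume "[j = l] (mod Q)" then show "r j = r l"
      by (simp add: r_def cong_def dvd_eq_mod_eq_0)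
  qed
  have r_pow: "x ^ r j = x ^ j" if "j > 0" for x :: 'a and j
    using r_cong[of j] r_pos[of j] that by (intro field_power_cong) (simp_all add: Q_def)
  define P where "P = Polynomial.monom \<alpha> (r m) + Polynomial.monom \<beta> (r k)"
  define P' where "P' = Polynomial.monom \<alpha>' (r m') + Polynomial.monom \<beta>' (r k')"
  have deg: "Polynomial.degree P \<le> Q" "Polynomial.degree P' \<le> Q"
    unfolding P_def P'_def using r_le
    by (meson Polynomial.degree_add_le degree_monom_le order_trans)+
  have "P = P'"
  proof (rule poly_eqI_degree)
    show "poly P x = poly P' x" if "x \<in> UNIV" for x
      using eq[of x] pos by (simp add: P_def P'_def poly_monom r_pow)
    show "Polynomial.degree P < CARD('a)" "Polynomial.degree P' < CARD('a)"
      using deg card_field_gt_1[where 'a='a] by (auto simp: Q_def)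
  qed
  then have "Polynomial.coeff P (r i) = Polynomial.coeff P' (r i)" by simp
  then show ?thesis
    unfolding P_def P'_def Q_def[symmetric] Polynomial.coeff_add coeff_monom r_eq .
qed

text \<open>Coefficients are compared at the classes of \<open>m\<close> and of \<open>k\<close>:
  being nonzero, \<open>\<alpha>\<close> and \<open>\<beta>\<close> must reappear on the right, and
  incongruence keeps monomials on either side from merging.\<close>

lemma binomial_fun_eqD:
  fixes \<alpha> \<beta> \<alpha>' \<beta>' :: "'a::finite_field"
  assumes eq: "\<And>x. \<alpha> * x ^ m + \<beta> * x ^ k = \<alpha>' * x ^ m' + \<beta>' * x ^ k'"
    and pos: "m > 0" "k > 0" "m' > 0" "k' > 0"
    and nz: "\<alpha> \<noteq> 0" "\<beta> \<noteq> 0"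
    and nc: "\<not> [m = k] (mod CARD('a) - 1)"  "\<not> [m' = k'] (mod CARD('a) - 1)"
  shows "[m = m'] (mod CARD('a) - 1) \<and> [k = k'] (mod CARD('a) - 1) \<and> \<alpha> = \<alpha>' \<and> \<beta> = \<beta>' \<or>
         [m = k'] (mod CARD('a) - 1) \<and> [k = m'] (mod CARD('a) - 1) \<and> \<alpha> = \<beta>' \<and> \<beta> = \<alpha>'"
proof -
  note c = binomial_fun_coeffs[OF eq pos]
  have excl: "\<not> ([m' = i] (mod CARD('a) - 1) \<and> [k' = i] (mod CARD('a) - 1))" for i
    using nc(2) cong_sym cong_trans by blast
  have 1: "[m' = m] (mod CARD('a) - 1) \<and> \<alpha> = \<alpha>' \<or> [k' = m] (mod CARD('a) - 1) \<and> \<alpha> = \<beta>'"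
    using c[of m] nz(1) nc(1) excl[of m] cong_sym[of k m]
    by (simp only: cong_refl if_True) (auto simp del: One_nat_def split: if_splits)
  have 2: "[m' = k] (mod CARD('a) - 1) \<and> \<beta> = \<alpha>' \<or> [k' = k] (mod CARD('a) - 1) \<and> \<beta> = \<beta>'"
    using c[of k] nz(2) nc(1) excl[of k]
    by (simp only: cong_refl if_True) (auto simp del: One_nat_def split: if_splits)
  from 1 2 nc show ?thesis by (metis cong_sym cong_trans)
qed

lemma CHAR_coprime_card_minus_1: "coprime CHAR('a::finite_field) (CARD('a) - 1)"
proof -
  have "CHAR('a) dvd CARD('a)" by (rule CHAR_dvd_CARD)
  moreover have "coprime CARD('a) (CARD('a) - 1)"
    using card_field_gt_1[where 'a='a] by (intro coprime_diff_one_right_nat) simp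
  ultimately show ?thesis using coprime_divisors dvd_refl by blast
qed

text \<open>The inverse is again a Frobenius power, as the equivalence admits only exponents p^j
  with j \<ge> 0. It exists by Euler's theorem, p being a unit modulo q - 1.\<close>

lemma frobenius_inverse:
  obtains j where "\<And>x :: 'a::finite_field. (x ^ CHAR('a) ^ i) ^ CHAR('a) ^ j = x"
proof
  let ?Q = "CARD('a) - 1"
  \<comment> \<open>Chosen so that \<open>i + ?j\<close> is \<open>i\<close> times the totient; the
    subtraction is exact because the totient is positive.\<close>
  let ?j = "i * (totient ?Q - 1)"
  fix x :: 'a
  have "totient ?Q > 0" using card_field_gt_1[where 'a='a] by simp
  then have "i + ?j = totient ?Q * i" by (cases "totient ?Q") simp_all
  then have "(x ^ CHAR('a) ^ i) ^ CHAR('a) ^ ?j = x ^ ((CHAR('a) ^ totient ?Q) ^ i)"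
    by (simp flip: power_mult power_add)
  also have "\<dots> = x ^ 1"
  proof (rule field_power_cong)
    have "[CHAR('a) ^ totient ?Q = 1] (mod ?Q)"
      by (rule euler_theorem) (rule CHAR_coprime_card_minus_1)
    from cong_pow[OF this, of i] show "[(CHAR('a) ^ totient ?Q) ^ i = 1] (mod ?Q)" by simp
  qed auto
  finally show "(x ^ CHAR('a) ^ i) ^ CHAR('a) ^ ?j = x" by simp
qed

lemma power_inverse_exponent:
  assumes "coprime s (CARD('a::finite_field) - 1)"
  obtains s' where "s' > 0" "coprime s' (CARD('a) - 1)"
    "\<And>x :: 'a. s > 0 \<Longrightarrow> x ^ (s * s') = x"
proof -
  let ?Q = "CARD('a) - 1"
  have Q: "?Q > 0" using card_field_gt_1[where 'a='a] by simp
  obtain r where r: "[s * r = 1] (mod ?Q)"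
    using assms coprime_iff_invertible_nat by auto
  define s' where "s' = r + ?Q"
  have s': "[s * s' = 1] (mod ?Q)"
    unfolding s'_def distrib_left using r by (simp add: cong_def del: One_nat_def)
  show thesis
  proof
    show "s' > 0" using Q by (simp add: s'_def)
    show "coprime s' ?Q" using s' coprime_iff_invertible_nat by (metis One_nat_def mult.commute)
    show "x ^ (s * s') = x" if "s > 0" for x :: 'a
      using field_power_cong[OF s', of x] that \<open>s' > 0\<close> by simp
  qed
qed

subsection \<open>Equivalence of binomials\<close>

text \<open>Raising to p^i is additive, so both monomials survive, and their exponents are
  multiplied by s * p^i, a unit modulo q - 1, which preserves the three incongruences.\<close>

lemma binomials_transform:
  fixes f :: "'a::finite_field \<Rightarrow> 'a"
  assumes "f \<in> binomials" "u \<noteq> 0" "v \<noteq> 0" "s > 0" "coprime s (CARD('a) - 1)"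
  shows "(\<lambda>x. u * f (v * x ^ s) ^ (CHAR('a) ^ i)) \<in> binomials"
proof -
  let ?Q = "CARD('a) - 1" and ?P = "CHAR('a) ^ i"
  obtain \<alpha> \<beta> m k where f: "f = (\<lambda>x. \<alpha> * x ^ m + \<beta> * x ^ k)" "\<alpha> \<noteq> 0" "\<beta> \<noteq> 0" "m > 0" "k > 0"
    and nc: "\<not> [m = 0] (mod ?Q)" "\<not> [k = 0] (mod ?Q)" "\<not> [m = k] (mod ?Q)"
    using assms(1) unfolding binomials_def by blast
  have t: "coprime (s * ?P) ?Q"
    using assms(5) CHAR_coprime_card_minus_1[where 'a='a] by simp
  have "(\<lambda>x. u * f (v * x ^ s) ^ ?P) =
      (\<lambda>x. (u * (\<alpha> * v ^ m) ^ ?P) * x ^ (s * ?P * m) + (u * (\<beta> * v ^ k) ^ ?P) * x ^ (s * ?P * k))"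
    by (simp add: f(1) freshmans_dream'[OF CHAR_prime refl] power_mult_distrib algebra_simps flip: power_mult)
  moreover have "\<not> [s * ?P * m = 0] (mod ?Q)" "\<not> [s * ?P * k = 0] (mod ?Q)"
      "\<not> [s * ?P * m = s * ?P * k] (mod ?Q)"
    using cong_mult_lcancel_nat[OF t, of _ 0] cong_mult_lcancel_nat[OF t, of m k] nc by simp_all
  ultimately show ?thesis
    unfolding binomials_def using assms(2-4) f(2-5)
    by (intro CollectI exI[of _ "u * (\<alpha> * v ^ m) ^ ?P"] exI[of _ "u * (\<beta> * v ^ k) ^ ?P"]
        exI[of _ "s * ?P * m"] exI[of _ "s * ?P * k"]) simp
qed

lemma binom_equivI:
  fixes f :: "'a::finite_field \<Rightarrow> 'a"
  assumes "f \<in> binomials" "u \<noteq> 0" "v \<noteq> 0" "s > 0" "coprime s (CARD('a) - 1)"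
    "\<And>x. g x = u * f (v * x ^ s) ^ (CHAR('a) ^ i)"
  shows "f \<sim>\<^sub>b g"
proof -
  have g: "g = (\<lambda>x. u * f (v * x ^ s) ^ (CHAR('a) ^ i))" using assms(6) by (rule ext)
  have "g \<in> binomials" unfolding g using assms(1-5) by (rule binomials_transform)
  moreover have "\<exists>u v i s. u \<noteq> 0 \<and> v \<noteq> 0 \<and> s > 0 \<and> gcd s (CARD('a) - 1) = 1 \<and>
      g = (\<lambda>x. u * f (v * x ^ s) ^ (CHAR('a) ^ i))"
    by (intro exI conjI) (rule assms(2-4) assms(5)[unfolded coprime_iff_gcd_eq_1] g)+
  ultimately show ?thesis
    unfolding binom_equiv_def using assms(1) by (intro conjI)
qed

lemma binom_equivE:
  fixes f :: "'a::finite_field \<Rightarrow> 'a"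
  assumes "f \<sim>\<^sub>b g"
  obtains u v s i where "u \<noteq> 0" "v \<noteq> 0" "s > 0" "coprime s (CARD('a) - 1)"
    "g = (\<lambda>x. u * f (v * x ^ s) ^ (CHAR('a) ^ i))"
  using assms unfolding binom_equiv_def coprime_iff_gcd_eq_1[symmetric]
  by (elim conjE exE) (rule that; assumption)

lemma binom_equiv_binomials:
  assumes "f \<sim>\<^sub>b g"
  shows "f \<in> binomials" "g \<in> binomials"
  using assms by (simp_all add: binom_equiv_def)

lemma binom_equiv_sym:
  fixes f :: "'a::finite_field \<Rightarrow> 'a"
  assumes "f \<sim>\<^sub>b g"
  shows "g \<sim>\<^sub>b f"
proof -
  obtain u v s i where h: "u \<noteq> 0" "v \<noteq> 0" "s > 0" "coprime s (CARD('a) - 1)"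
    and g: "g = (\<lambda>x. u * f (v * x ^ s) ^ (CHAR('a) ^ i))"
    using assms by (rule binom_equivE)
  obtain j where j: "\<And>x :: 'a. (x ^ CHAR('a) ^ i) ^ CHAR('a) ^ j = x"
    using frobenius_inverse by blast
  obtain s' where s': "s' > 0" "coprime s' (CARD('a) - 1)" "\<And>x :: 'a. x ^ (s * s') = x"
    using power_inverse_exponent[OF h(4)] h(3) by metis
  show ?thesis
  proof (rule binom_equivI)
    fix x
    have "v * (inverse v ^ s' * x ^ s') ^ s = x"
      using s'(3)[of "inverse v * x"] h(2) by (simp add: power_mult_distrib power_mult[symmetric] mult.commute)
    then show "f x = inverse u ^ CHAR('a) ^ j * g (inverse v ^ s' * x ^ s') ^ CHAR('a) ^ j"
      using h(1) by (simp add: g power_mult_distrib j power_inverse)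
  qed (use h s' binom_equiv_binomials[OF assms] in simp_all)
qed

lemma binom_equiv_trans:
  fixes f :: "'a::finite_field \<Rightarrow> 'a"
  assumes "f \<sim>\<^sub>b g" "g \<sim>\<^sub>b h"
  shows "f \<sim>\<^sub>b h"
proof -
  obtain u v s i where 1: "u \<noteq> 0" "v \<noteq> 0" "s > 0" "coprime s (CARD('a) - 1)"
    and g: "g = (\<lambda>x. u * f (v * x ^ s) ^ (CHAR('a) ^ i))"
    using assms(1) by (rule binom_equivE)
  obtain u' v' s' i' where 2: "u' \<noteq> 0" "v' \<noteq> 0" "s' > 0" "coprime s' (CARD('a) - 1)"
    and h: "h = (\<lambda>x. u' * g (v' * x ^ s') ^ (CHAR('a) ^ i'))"
    using assms(2) by (rule binom_equivE)
  show ?thesis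
  proof (rule binom_equivI)
    fix x
    show "h x = (u' * u ^ CHAR('a) ^ i') * f (v * v' ^ s * x ^ (s * s')) ^ CHAR('a) ^ (i + i')"
      by (simp add: h g power_mult_distrib power_add mult_ac flip: power_mult)
  qed (use 1 2 binom_equiv_binomials[OF assms(1)] in simp_all)
qed

text \<open>Scalings, x^s and Frobenius powers are all invertible. This passes the permutation
  property on to the normal form.\<close>

lemma binom_equiv_inj:
  fixes f :: "'a::finite_field \<Rightarrow> 'a"
  assumes "f \<sim>\<^sub>b g" "inj f"
  shows "inj g"
proof (rule injI)
  fix x y assume xy: "g x = g y"
  obtain u v s i where h: "u \<noteq> 0" "v \<noteq> 0" "s > 0" "coprime s (CARD('a) - 1)"
    and g: "g = (\<lambda>x. u * f (v * x ^ s) ^ (CHAR('a) ^ i))"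
    using assms(1) by (rule binom_equivE)
  obtain j where j: "\<And>x :: 'a. (x ^ CHAR('a) ^ i) ^ CHAR('a) ^ j = x"
    using frobenius_inverse by blast
  obtain s' where s': "\<And>x :: 'a. x ^ (s * s') = x"
    using power_inverse_exponent[OF h(4)] h(3) by metis
  have "f (v * x ^ s) ^ (CHAR('a) ^ i) = f (v * y ^ s) ^ (CHAR('a) ^ i)"
    using xy h(1) by (simp add: g)
  from arg_cong[OF this, of "\<lambda>z. z ^ CHAR('a) ^ j"]
  have "f (v * x ^ s) = f (v * y ^ s)" by (simp add: j)
  from injD[OF assms(2) this] have "x ^ s = y ^ s" using h(2) by simp
  from arg_cong[OF this, of "\<lambda>z. z ^ s'"] show "x = y"
    unfolding power_mult[symmetric] s' .
qed

subsection \<open>Exponent pairs modulo \<open>Q\<close>\<close>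

text \<open>Each prime divisor of \<open>Q\<close> divides exactly one of \<open>b\<close> and
  \<open>\<Prod>S * m\<close>, hence not their sum. This lifts units modulo \<open>m\<close> to
  units modulo \<open>Q\<close>.\<close>

lemma exists_coprime_in_class:
  fixes b m Q :: int
  assumes "coprime b m" "m dvd Q" "Q \<noteq> 0"
  shows "\<exists>t. coprime t Q \<and> [t = b] (mod m)"
proof -
  define S where "S = {r. prime r \<and> r dvd Q \<and> \<not> r dvd b}"
  have fin: "finite S"
    by (rule finite_subset[OF _ finite_divisors_int[OF assms(3)]]) (auto simp: S_def)
  define t where "t = b + \<Prod>S * m"
  have "coprime t Q"
  proof (rule ccontr)
    assume "\<not> coprime t Q"
    then have "\<not> is_unit (gcd t Q)" by (simp add: coprime_iff_gcd_eq_1)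
    then obtain r where "prime r" "r dvd gcd t Q"
      using prime_divisor_exists[of "gcd t Q"] assms(3) by auto
    then have r: "prime r" "r dvd t" "r dvd Q" by simp_all
    show False
    proof (cases "r dvd b")
      case True
      with r(2) have "r dvd \<Prod>S * m" by (simp add: t_def dvd_add_right_iff)
      moreover have "\<not> r dvd m"
        using assms(1) True r(1) by (meson coprime_common_divisor not_prime_unit)
      moreover have "\<not> r dvd \<Prod>S"
      proof
        assume "r dvd \<Prod>S"
        then obtain r' where "r' \<in> S" "r dvd r'"
          using prime_dvd_prod_iff[OF fin r(1), of id] by auto
        then have "r = r'" using r(1) by (auto simp: S_def intro: primes_dvd_imp_eq)
        with \<open>r' \<in> S\<close> True show False by (simp add: S_def)
      qed
      ultimately show False using r(1) by (simp add: prime_dvd_mult_iff)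
    next
      case False
      then have "r \<in> S" using r by (simp add: S_def)
      then have "r dvd \<Prod>S * m" using dvd_prodI[OF fin, of r "\<lambda>x. x"] by simp
      with r(2) False show False by (simp add: t_def dvd_add_left_iff)
    qed
  qed
  moreover have "[t = b] (mod m)" by (simp add: t_def cong_def)
  ultimately show ?thesis by blast
qed

text \<open>After division by the gcd g, the cofactor of \<open>a\<close> is invertible modulo Q /
  g, and its inverse lifts to a unit modulo \<open>Q\<close>. This normalises an exponent difference
  to a divisor of \<open>Q\<close>.\<close>

lemma exists_unit_mult_cong_gcd:
  fixes a Q :: int
  assumes "Q > 0"
  shows "\<exists>t. coprime t Q \<and> [t * a = gcd a Q] (mod Q)"
proof -
  define g where "g = gcd a Q"
  have g: "g > 0" using assms by (simp add: g_def)
  obtain a' m where a': "a = a' * g" "Q = m * g" "coprime a' m"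
    using gcd_coprime_exists[of a Q] g unfolding g_def by auto
  obtain b where b: "[a' * b = 1] (mod m)"
    using cong_solve_coprime_int[OF a'(3)] by blast
  then have "coprime b m" using coprime_iff_invertible_int by (metis mult.commute)
  moreover have "m dvd Q" using a'(2) by simp
  moreover have "Q \<noteq> 0" using assms by simp
  ultimately obtain t where t: "coprime t Q" "[t = b] (mod m)"
    using exists_coprime_in_class by blast
  have "[t * a' = 1] (mod m)"
    using cong_mult[OF t(2) cong_refl[of a']] b by (metis cong_trans mult.commute)
  then have "[t * a' * g = 1 * g] (mod m * g)" by (rule cong_cmult_rightI)
  then have "[t * a = gcd a Q] (mod Q)"
    unfolding g_def[symmetric] by (simp add: a' mult.assoc)
  with t(1) show ?thesis by blast
qed

text \<open>Turns the conditions t \<equiv> \<plusminus>1 in the definition of n* into statements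
  about how \<open>t\<close> moves the exponent difference \<open>d\<close> modulo
  \<open>Q\<close>.\<close>

lemma cong_quotient_iff:
  fixes t e :: int
  assumes "d dvd Q" "Q > 0"
  shows "[t = e] (mod int (Q div d)) \<longleftrightarrow> [t * int d = e * int d] (mod int Q)"
proof -
  obtain m where m: "Q = d * m" using assms(1) by blast
  with assms(2) have "d > 0" "m > 0" by simp_all
  then show ?thesis by (simp add: m cong_iff_dvd_diff mult.commute flip: left_diff_distrib)
qed

text \<open>Multiplication by the unit \<open>t\<close> maps the exponent pair \<open>{n, n + d}\<close> to \<open>{n', n' + d}\<close>; the
  two cases correspond to \<open>t \<equiv> 1\<close> and \<open>t \<equiv> -1\<close> modulo \<open>Q / d\<close> in the definition of \<open>n\<^sup>*\<close>.\<close>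

definition pair_rel :: "nat \<Rightarrow> nat \<Rightarrow> nat \<Rightarrow> nat \<Rightarrow> bool" where
  "pair_rel Q d n n' \<longleftrightarrow> (\<exists>t::int. coprime t (int Q) \<and>
     ([t * int n = int n'] (mod int Q) \<and> [t * (int n + int d) = int n' + int d] (mod int Q) \<or>
      [t * int n = int n' + int d] (mod int Q) \<and> [t * (int n + int d) = int n'] (mod int Q)))"

lemma pair_rel_refl: "pair_rel Q d n n"
  unfolding pair_rel_def by (rule exI[of _ 1]) simp

lemma pair_rel_sym:
  assumes "pair_rel Q d n n'"
  shows "pair_rel Q d n' n"
proof -
  obtain t where t: "coprime t (int Q)"
    and *: "[t * int n = int n'] (mod int Q) \<and> [t * (int n + int d) = int n' + int d] (mod int Q) \<or>
      [t * int n = int n' + int d] (mod int Q) \<and> [t * (int n + int d) = int n'] (mod int Q)"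
    using assms unfolding pair_rel_def by blast
  obtain t' where t': "[t' * t = 1] (mod int Q)"
    using cong_solve_coprime_int[OF t] by (metis mult.commute)
  have inv: "[t' * y = x] (mod int Q)" if "[t * x = y] (mod int Q)" for x y
  proof -
    have "[t' * y = t' * (t * x)] (mod int Q)"
      using that by (intro cong_mult cong_refl) (rule cong_sym)
    also have "t' * (t * x) = (t' * t) * x" by simp
    also have "[\<dots> = 1 * x] (mod int Q)" using t' by (intro cong_mult cong_refl)
    finally show ?thesis by simp
  qed
  have "coprime t' (int Q)" using t' coprime_iff_invertible_int by blast
  with * show ?thesis unfolding pair_rel_def by (intro exI[of _ t']) (auto intro: inv)
qed

lemma pair_rel_trans:
  assumes "pair_rel Q d n n'" "pair_rel Q d n' n''"
  shows "pair_rel Q d n n''"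
proof -
  obtain t where t: "coprime t (int Q)"
    and *: "[t * int n = int n'] (mod int Q) \<and> [t * (int n + int d) = int n' + int d] (mod int Q) \<or>
      [t * int n = int n' + int d] (mod int Q) \<and> [t * (int n + int d) = int n'] (mod int Q)"
    using assms(1) unfolding pair_rel_def by blast
  obtain s where s: "coprime s (int Q)"
    and **: "[s * int n' = int n''] (mod int Q) \<and> [s * (int n' + int d) = int n'' + int d] (mod int Q) \<or>
      [s * int n' = int n'' + int d] (mod int Q) \<and> [s * (int n' + int d) = int n''] (mod int Q)"
    using assms(2) unfolding pair_rel_def by blast
  have comp: "[s * t * x = z] (mod int Q)" if "[t * x = y] (mod int Q)" "[s * y = z] (mod int Q)" for x y z
    using cong_mult[OF cong_refl[of s] that(1)] that(2) by (metis cong_trans mult.assoc)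
  have "coprime (s * t) (int Q)" using s t by simp
  with * ** show ?thesis unfolding pair_rel_def
    by (intro exI[of _ "s * t"]) (blast intro: comp)
qed

lemma cong_add_cancel_int:
  fixes a b c e m :: int
  assumes "[a = b] (mod m)"
  shows "[a + c = b + e] (mod m) \<longleftrightarrow> [c = e] (mod m)"
  using assms by (metis cong_add cong_add_lcancel cong_refl cong_sym cong_trans)

text \<open>Once the image of \<open>n\<close> under \<open>t\<close> is prescribed, the condition
  on \<open>t * (n + d)\<close> concerns \<open>t * d\<close> alone, which is a condition on
  \<open>t\<close> modulo \<open>Q div d\<close>.\<close>

lemma pair_rel_iff:
  assumes "d dvd Q" "Q > 0"
  shows "pair_rel Q d n n' \<longleftrightarrow>
     (\<exists>t::int. coprime t (int Q) \<and> [t = 1] (mod int (Q div d)) \<and> [int n' = t * int n] (mod int Q)) \<or>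
     (\<exists>t::int. coprime t (int Q) \<and> [t = - 1] (mod int (Q div d)) \<and>
         [int n' = t * int n - int d] (mod int Q))"
proof -
  have 1: "[t * int n = int n'] (mod int Q) \<and> [t * (int n + int d) = int n' + int d] (mod int Q) \<longleftrightarrow>
      [t = 1] (mod int (Q div d)) \<and> [int n' = t * int n] (mod int Q)" for t
    unfolding cong_quotient_iff[OF assms] distrib_left
    using cong_add_cancel_int[of "t * int n" "int n'" "int Q" "t * int d" "int d"]
    by (auto simp: cong_sym_eq)
  have 2: "[t * int n = int n' + int d] (mod int Q) \<and> [t * (int n + int d) = int n'] (mod int Q) \<longleftrightarrow>
      [t = - 1] (mod int (Q div d)) \<and> [int n' = t * int n - int d] (mod int Q)" for t
  proof -
    have "[t * int n = int n' + int d] (mod int Q) \<longleftrightarrow> [int n' = t * int n - int d] (mod int Q)"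
      by (auto simp: cong_iff_dvd_diff algebra_simps dvd_diff_commute)
    moreover have "[t * (int n + int d) = int n'] (mod int Q) \<longleftrightarrow> [t * int d = - 1 * int d] (mod int Q)"
      if "[t * int n = int n' + int d] (mod int Q)"
      using cong_add_cancel_int[OF that, of "t * int d" "- int d"] by (simp add: distrib_left)
    ultimately show ?thesis unfolding cong_quotient_iff[OF assms] by blast
  qed
  show ?thesis unfolding pair_rel_def using 1 2 by blast
qed

section \<open>Least representatives of the classes of exponent pairs\<close>

lemma nstar_eq_Least:
  assumes "d dvd q - 1" "q > 1"
  shows "nstar q d n = (LEAST n'. n' \<in> {1..q - 1} \<and> pair_rel (q - 1) d n n')"
  using assms unfolding nstar_def by (subst pair_rel_iff) simp_all

lemma nstar_props:
  assumes "d dvd q - 1" "q > 1" "n \<in> {1..q - 1}"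
  shows "nstar q d n \<in> {1..q - 1}" "pair_rel (q - 1) d n (nstar q d n)"
proof -
  have "n \<in> {1..q - 1} \<and> pair_rel (q - 1) d n n" using assms(3) pair_rel_refl by simp
  from LeastI[of "\<lambda>n'. n' \<in> {1..q - 1} \<and> pair_rel (q - 1) d n n'", OF this]
  show "nstar q d n \<in> {1..q - 1}" "pair_rel (q - 1) d n (nstar q d n)"
    unfolding nstar_eq_Least[OF assms(1,2)] by blast+
qed

lemma nstar_cong:
  assumes "d dvd q - 1" "q > 1" "pair_rel (q - 1) d n n'"
  shows "nstar q d n = nstar q d n'"
proof -
  have "pair_rel (q - 1) d n x \<longleftrightarrow> pair_rel (q - 1) d n' x" for x
    using assms(3) pair_rel_sym pair_rel_trans by blast
  then show ?thesis unfolding nstar_eq_Least[OF assms(1,2)] by simp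
qed

lemma nstar_in_N_set:
  assumes "d dvd q - 1" "q > 1" "n \<in> {1..q - 1}"
  shows "nstar q d n \<in> N_set q d"
  using nstar_props[OF assms] nstar_cong[OF assms(1,2)] unfolding N_set_def by blast

lemma N_set_unique:
  assumes "d dvd q - 1" "q > 1" "n \<in> N_set q d" "n' \<in> N_set q d" "pair_rel (q - 1) d n n'"
  shows "n = n'"
  using assms nstar_cong[of d q n n'] by (simp add: N_set_def)

subsection \<open>Binomials in normal form\<close>

definition normal_binom :: "nat \<Rightarrow> nat \<Rightarrow> 'a::field \<Rightarrow> 'a \<Rightarrow> 'a" where
  "normal_binom n d a = (\<lambda>x. x ^ n * (x ^ d + a))"

lemma normal_binom_apply: "normal_binom n d a x = 1 * x ^ (n + d) + a * x ^ n"
  by (simp add: normal_binom_def power_add algebra_simps)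

text \<open>Congruent exponents would leave a multiple of the single power x^n. The nonzero
  coefficients at \<open>m\<close> and \<open>k\<close> would then force both to be congruent to
  \<open>n\<close>.\<close>

lemma normal_binom_exponents_incong:
  fixes a :: "'a::finite_field"
  assumes bin: "normal_binom n d a \<in> binomials" and "n > 0"
  shows "\<not> [n + d = n] (mod CARD('a) - 1)"
proof
  let ?Q = "CARD('a) - 1"
  assume nd: "[n + d = n] (mod ?Q)"
  obtain \<alpha> \<beta> m k where f: "normal_binom n d a = (\<lambda>x. \<alpha> * x ^ m + \<beta> * x ^ k)"
    and nz: "\<alpha> \<noteq> 0" "\<beta> \<noteq> 0" "m > 0" "k > 0" and nc: "\<not> [m = k] (mod ?Q)"
    using bin unfolding binomials_def by blast
  have eq: "\<alpha> * x ^ m + \<beta> * x ^ k = 1 * x ^ (n + d) + a * x ^ n" for x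
    using fun_cong[OF f, of x] unfolding normal_binom_apply by simp
  note c = binomial_fun_coeffs[OF eq nz(3,4)]
  have "[n = m] (mod ?Q)"
  proof (rule ccontr)
    assume 1: "\<not> [n = m] (mod ?Q)"
    with nd have 2: "\<not> [n + d = m] (mod ?Q)" using cong_sym cong_trans by blast
    have 3: "\<not> [k = m] (mod ?Q)" using nc cong_sym by blast
    show False using c[of m] assms(2) nz(1) 1 2 3 by (simp del: One_nat_def)
  qed
  moreover have "[n = k] (mod ?Q)"
  proof (rule ccontr)
    assume 1: "\<not> [n = k] (mod ?Q)"
    with nd have 2: "\<not> [n + d = k] (mod ?Q)" using cong_sym cong_trans by blast
    show False using c[of k] assms(2) nz(2) 1 2 nc by (simp del: One_nat_def)
  qed
  ultimately show False using nc cong_sym cong_trans by blast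
qed

lemma nat_representative_unit:
  fixes t :: int
  assumes "coprime t (int Q)" "Q > 0"
  obtains s :: nat where "s > 0" "coprime s Q" "[int s = t] (mod int Q)"
proof
  \<comment> \<open>The summand \<open>Q\<close> keeps the exponent positive even when the residue
    is 0.\<close>
  let ?s = "nat (t mod int Q) + Q"
  have s: "int ?s = t mod int Q + int Q" using assms(2) by simp
  show cong: "[int ?s = t] (mod int Q)" unfolding s by (simp add: cong_def)
  have "coprime (int ?s) (int Q)"
    using assms(1) cong_imp_coprime cong_sym[OF cong] by blast
  then show "coprime ?s Q" by (simp only: coprime_int_iff)
qed (use assms in simp)

text \<open>Substitute x^s with s \<equiv> t and divide by \<open>\<alpha>\<close>. Either monomial
  may play the leading role; exchanging the roles inverts the resulting coefficient.\<close>

lemma binom_equiv_normal_binomI: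
  fixes \<alpha> \<beta> :: "'a::finite_field"
  assumes f: "f \<in> binomials" "\<And>x. f x = \<alpha> * x ^ m + \<beta> * x ^ k"
    and pos: "\<alpha> \<noteq> 0" "m > 0" "k > 0" "n > 0"
    and t: "coprime t (int (CARD('a) - 1))"
      "[t * int m = int n + int d] (mod int (CARD('a) - 1))"
      "[t * int k = int n] (mod int (CARD('a) - 1))"
  shows "f \<sim>\<^sub>b normal_binom n d (\<beta> / \<alpha>)"
proof -
  have "CARD('a) - 1 > 0" using card_field_gt_1[where 'a='a] by simp
  then obtain s where s: "s > 0" "coprime s (CARD('a) - 1)" "[int s = t] (mod int (CARD('a) - 1))"
    using nat_representative_unit[OF t(1)] by blast
  have m: "[int (s * m) = int (n + d)] (mod int (CARD('a) - 1))"
    using cong_trans[OF cong_mult[OF s(3) cong_refl[of "int m"]] t(2)] by simp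
  have k: "[int (s * k) = int n] (mod int (CARD('a) - 1))"
    using cong_trans[OF cong_mult[OF s(3) cong_refl[of "int k"]] t(3)] by simp
  show ?thesis
  proof (rule binom_equivI[where u = "inverse \<alpha>" and v = 1 and s = s and i = 0])
    fix x :: 'a
    have "x ^ (n + d) = x ^ (s * m)" "x ^ n = x ^ (s * k)"
      using field_power_cong_int[OF m, of x] field_power_cong_int[OF k, of x] pos s(1) by simp_all
    then show "normal_binom n d (\<beta> / \<alpha>) x = inverse \<alpha> * f (1 * x ^ s) ^ CHAR('a) ^ 0"
      using pos(1) unfolding normal_binom_apply f(2) by (simp add: field_simps flip: power_mult)
  qed (use f pos s in simp_all)
qed

lemma normal_binom_equiv_pair_rel:
  fixes a :: "'a::finite_field"
  assumes "normal_binom n d a \<in> binomials" "a \<noteq> 0" "n > 0" "n' > 0"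
    and "pair_rel (CARD('a) - 1) d n n'"
  shows "\<exists>b. b \<noteq> 0 \<and> normal_binom n d a \<sim>\<^sub>b normal_binom n' d b"
proof -
  obtain t where t: "coprime t (int (CARD('a) - 1))"
    and "[t * int n = int n'] (mod int (CARD('a) - 1)) \<and>
         [t * (int n + int d) = int n' + int d] (mod int (CARD('a) - 1)) \<or>
       [t * int n = int n' + int d] (mod int (CARD('a) - 1)) \<and>
         [t * (int n + int d) = int n'] (mod int (CARD('a) - 1))"
    using assms(5) unfolding pair_rel_def by blast
  then consider
      "[t * int n = int n'] (mod int (CARD('a) - 1))" "[t * int (n + d) = int n' + int d] (mod int (CARD('a) - 1))"
    | "[t * int n = int n' + int d] (mod int (CARD('a) - 1))" "[t * int (n + d) = int n'] (mod int (CARD('a) - 1))"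
    unfolding of_nat_add by blast
  then show ?thesis
  proof cases
    case 1
    have "normal_binom n d a \<sim>\<^sub>b normal_binom n' d (a / 1)"
      by (rule binom_equiv_normal_binomI[OF assms(1) normal_binom_apply _ _ _ _ t 1(2,1)])
        (use assms in simp_all)
    with assms(2) show ?thesis by auto
  next
    case 2
    \<comment> \<open>Here \<open>t\<close> sends \<open>n\<close> to the larger exponent
      \<open>n' + d\<close>, so x^n becomes the leading monomial and normalising divides by
      \<open>a\<close>.\<close>
    have "normal_binom n d a x = a * x ^ n + 1 * x ^ (n + d)" for x
      by (simp add: normal_binom_apply)
    from binom_equiv_normal_binomI[OF assms(1) this _ _ _ _ t 2]
    have "normal_binom n d a \<sim>\<^sub>b normal_binom n' d (1 / a)" using assms by simp
    moreover have "1 / a \<noteq> 0" using assms(2) by simp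
    ultimately show ?thesis by blast
  qed
qed

section \<open>Equivalences that change only the coefficient\<close>

lemma normal_binom_equiv_scale:
  fixes a :: "'a::finite_field"
  assumes "normal_binom n d a \<in> binomials" "w \<noteq> 0"
  shows "normal_binom n d a \<sim>\<^sub>b normal_binom n d (a * w ^ d)"
\<comment> \<open>Replacing x by x / w divides the leading term by w^(n + d); \<open>u\<close>
  repairs this and leaves w^d on the other term.\<close>
proof (rule binom_equivI[where u = "w ^ (n + d)" and v = "inverse w" and s = 1 and i = 0])
  fix x
  show "normal_binom n d (a * w ^ d) x =
      w ^ (n + d) * normal_binom n d a (inverse w * x ^ 1) ^ CHAR('a) ^ 0"
    using assms(2) by (simp add: normal_binom_def power_add power_mult_distrib power_inverse field_simps)
qed (use assms in simp_all)

text \<open>Frobenius also multiplies the exponents by p; substituting x^s, with s inverse to p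
  modulo q - 1, restores them.\<close>

lemma normal_binom_equiv_power_CHAR:
  fixes a :: "'a::finite_field"
  assumes "normal_binom n d a \<in> binomials" "n > 0"
  shows "normal_binom n d a \<sim>\<^sub>b normal_binom n d (a ^ CHAR('a))"
proof -
  obtain s where s: "s > 0" "coprime s (CARD('a) - 1)" "\<And>x :: 'a. x ^ (CHAR('a) * s) = x"
    using power_inverse_exponent[OF CHAR_coprime_card_minus_1[where 'a='a]] CHAR_pos[where 'a='a] by metis
  show ?thesis
  proof (rule binom_equivI[where u = 1 and v = 1 and s = s and i = 1])
    fix x :: 'a
    have p: "((x ^ s) ^ j) ^ CHAR('a) = x ^ j" for j
      using s(3)[of "x ^ j"] by (simp add: mult_ac flip: power_mult)
    show "normal_binom n d (a ^ CHAR('a)) x = 1 * normal_binom n d a (1 * x ^ s) ^ CHAR('a) ^ 1"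
      by (simp add: normal_binom_def power_mult_distrib freshmans_dream[OF CHAR_prime refl] p)
  qed (use assms s in simp_all)
qed

text \<open>Under these two conditions some unit exchanges \<open>n\<close> and
  \<open>n + d\<close>, hence the two monomials, and normalising divides by
  \<open>a\<close>.\<close>

lemma normal_binom_equiv_inverse:
  fixes a :: "'a::finite_field"
  assumes bin: "normal_binom n d a \<in> binomials" and "a \<noteq> 0" "n > 0" "d dvd CARD('a) - 1"
    and G: "[int d = - 2 * int n] (mod int ((CARD('a) - 1) div d))" "gcd n (CARD('a) - 1) = 1"
  shows "normal_binom n d a \<sim>\<^sub>b normal_binom n d (inverse a)"
proof -
  define Q where "Q = CARD('a) - 1"
  have Q: "Q > 0" using card_field_gt_1[where 'a='a] by (simp add: Q_def)
  note G = G[folded Q_def]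
  have dQ: "d dvd Q" using assms(4) by (simp add: Q_def)
  have cop: "coprime (int n) (int Q)" using G(2) by (simp add: coprime_iff_gcd_eq_1)
  obtain m where m: "[int n * m = 1] (mod int Q)"
    using cong_solve_coprime_int[OF cop] by blast
  \<comment> \<open>The solution of t n \<equiv> n + d, as \<open>m\<close> inverts
    \<open>n\<close>.\<close>
  define t where "t = 1 + int d * m"
  have tn: "[t * int n = int n + int d] (mod int Q)"
    using cong_add[OF cong_refl[of "int n"] cong_mult[OF cong_refl[of "int d"] m]]
    by (simp add: t_def algebra_simps)
  have "int (Q div d) dvd int Q" using dQ by (metis dvd_div_mult_self dvd_triv_left of_nat_dvd_iff)
  then have m': "[int n * m = 1] (mod int (Q div d))" using m cong_dvd_mono_modulus by blast
  have "[int d * m = - 2 * (int n * m)] (mod int (Q div d))"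
    using cong_mult[OF G(1) cong_refl[of m]] by (simp add: mult.assoc)
  also have "[- 2 * (int n * m) = - 2 * 1] (mod int (Q div d))"
    by (intro cong_mult cong_refl m')
  finally have "[t = - 1] (mod int (Q div d))"
    using cong_add[OF cong_refl[of 1]] by (fastforce simp: t_def)
  then have td: "[t * int d = - int d] (mod int Q)" using cong_quotient_iff[OF dQ Q, of t "-1"] by simp
  have tnd: "[t * int (n + d) = int n] (mod int Q)"
    using cong_add[OF tn td] by (simp add: distrib_left)
  \<comment> \<open>Applying \<open>t\<close> twice fixes the unit \<open>n\<close>, so
    \<open>t\<close> is its own inverse.\<close>
  have "[t * (t * int n) = int n] (mod int Q)"
    using cong_mult[OF cong_refl[of t] tn] tnd by (metis cong_trans of_nat_add)
  then have "[int n * (t * t) = int n * 1] (mod int Q)" by (simp add: mult_ac)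
  then have "[t * t = 1] (mod int Q)" using cong_mult_lcancel[OF cop] by blast
  then have t: "coprime t (int Q)" using coprime_iff_invertible_int by blast
  have "normal_binom n d a x = a * x ^ n + 1 * x ^ (n + d)" for x
    by (simp add: normal_binom_apply)
  from binom_equiv_normal_binomI[OF bin this _ _ _ _ t[unfolded Q_def] tn[unfolded Q_def] tnd[unfolded Q_def]]
  show ?thesis using assms by (simp add: inverse_eq_divide)
qed

section \<open>Data forced by an equivalence of normal forms\<close>

lemma dvd_cong_unit_mult_eq:
  fixes t e :: int and d d' Q :: nat
  assumes "coprime t (int Q)" "e = 1 \<or> e = - 1" "[t * int d = e * int d'] (mod int Q)" "d dvd Q" "d' dvd Q"
  shows "d = d'"
proof -
  \<comment> \<open>Units and signs do not affect the gcd with \<open>Q\<close>, and a divisor of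
    \<open>Q\<close> is its own gcd.\<close>
  have "gcd (t * int d) (int Q) = gcd (e * int d') (int Q)" using assms(3) by (rule cong_gcd_eq)
  moreover have "gcd (t * int d) (int Q) = gcd (int d) (int Q)"
    using assms(1) by (simp add: gcd_mult_left_left_cancel coprime_commute)
  moreover have "gcd (e * int d') (int Q) = gcd (int d') (int Q)" using assms(2) by auto
  ultimately show ?thesis using assms(4,5) by (simp add: gcd_proj1_if_dvd)
qed

text \<open>Coefficient comparison matches the exponents, multiplied by the unit s * p^i, either in
  order or crosswise. Subtracting the two congruences sends \<open>d\<close> to \<open>d'\<close> or
  its negative, whence \<open>d = d'\<close>.\<close>

lemma normal_binom_equivD:
  fixes a a' :: "'a::finite_field"
  assumes eq: "normal_binom n d a \<sim>\<^sub>b normal_binom n' d' a'"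
    and pos: "n > 0" "n' > 0" "a \<noteq> 0" "a' \<noteq> 0"
    and dvd: "d dvd CARD('a) - 1" "d' dvd CARD('a) - 1"
  obtains t i w where "d = d'" "coprime t (int (CARD('a) - 1))" "w \<noteq> 0"
    "[t * int n = int n'] (mod int (CARD('a) - 1)) \<and>
        [t * (int n + int d) = int n' + int d] (mod int (CARD('a) - 1)) \<and> a' = a ^ CHAR('a) ^ i * w ^ d \<or>
     [t * int n = int n' + int d] (mod int (CARD('a) - 1)) \<and>
        [t * (int n + int d) = int n'] (mod int (CARD('a) - 1)) \<and> a' = inverse (a ^ CHAR('a) ^ i) * w ^ d"
proof -
  define Q where "Q = CARD('a) - 1"
  obtain u v s i where h: "u \<noteq> 0" "v \<noteq> 0" "s > 0" "coprime s Q"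
    and g: "normal_binom n' d' a' = (\<lambda>x. u * normal_binom n d a (v * x ^ s) ^ (CHAR('a) ^ i))"
    using eq unfolding Q_def by (rule binom_equivE)
  define P where "P = CHAR('a) ^ i"
  define T where "T = s * P"
  have T: "coprime T Q" "T > 0"
    using h(3,4) CHAR_coprime_card_minus_1[where 'a='a] by (simp_all add: T_def P_def Q_def)
  have fun_eq: "(u * v ^ ((n + d) * P)) * x ^ (T * (n + d)) + (u * v ^ (n * P) * a ^ P) * x ^ (T * n)
      = 1 * x ^ (n' + d') + a' * x ^ n'" for x
  proof -
    have "1 * x ^ (n' + d') + a' * x ^ n' = u * (1 * (v * x ^ s) ^ (n + d) + a * (v * x ^ s) ^ n) ^ P"
      using fun_cong[OF g, of x] unfolding normal_binom_apply P_def .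
    also have "\<dots> = u * ((1 * (v * x ^ s) ^ (n + d)) ^ P + (a * (v * x ^ s) ^ n) ^ P)"
      unfolding P_def by (simp add: freshmans_dream'[OF CHAR_prime refl])
    also have "\<dots> = (u * v ^ ((n + d) * P)) * x ^ (T * (n + d)) + (u * v ^ (n * P) * a ^ P) * x ^ (T * n)"
      unfolding T_def power_mult_distrib power_mult[symmetric] power_one mult_1 distrib_left[of u]
      by (simp only: mult_ac)
    finally show ?thesis by simp
  qed
  have nc: "\<not> [n + d = n] (mod Q)" "\<not> [n' + d' = n'] (mod Q)"
    using normal_binom_exponents_incong binom_equiv_binomials[OF eq] pos(1,2) unfolding Q_def by blast+
  have nc1: "\<not> [T * (n + d) = T * n] (mod Q)" using nc(1) cong_mult_lcancel_nat[OF T(1)] by blast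
  have c: "coprime (int T) (int Q)" using T(1) by simp
  from binomial_fun_eqD[OF fun_eq _ _ _ _ _ _ nc1[unfolded Q_def] nc(2)[unfolded Q_def]]
  consider
      (same) "[T * (n + d) = n' + d'] (mod Q)" "[T * n = n'] (mod Q)"
        "u * v ^ ((n + d) * P) = 1" "u * v ^ (n * P) * a ^ P = a'"
    | (swap) "[T * (n + d) = n'] (mod Q)" "[T * n = n' + d'] (mod Q)"
        "u * v ^ ((n + d) * P) = a'" "u * v ^ (n * P) * a ^ P = 1"
    using T(2) pos h(1,2) unfolding Q_def[symmetric] by fastforce
  then show thesis
  proof cases
    case same
    have 1: "[int T * int n = int n'] (mod int Q)"
      using same(2) by (metis cong_int_iff of_nat_mult)
    have 2: "[int T * (int n + int d) = int n' + int d'] (mod int Q)"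
      using same(1) by (metis cong_int_iff of_nat_mult of_nat_add)
    have "[int T * int d = 1 * int d'] (mod int Q)"
      using cong_diff[OF 2 1] by (simp add: algebra_simps)
    then have d: "d = d'" using dvd_cong_unit_mult_eq[OF c] dvd unfolding Q_def by blast
    \<comment> \<open>The leading coefficient being 1 eliminates \<open>u\<close> and leaves a d-th
      power.\<close>
    have "a' = a ^ P * (u * v ^ ((n + d) * P)) * inverse (v ^ (d * P))"
      using h(2) unfolding same(4)[symmetric] by (simp add: distrib_right power_add field_simps)
    then have "a' = a ^ P * (inverse v ^ P) ^ d"
      unfolding same(3) by (simp add: power_inverse mult.commute flip: power_mult)
    then show thesis
      using that[of "int T" "inverse v ^ P" i] d c 1 2 h(2) unfolding P_def Q_def by simp
  next
    case swap
    have 1: "[int T * int n = int n' + int d'] (mod int Q)"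
      using swap(2) by (metis cong_int_iff of_nat_mult of_nat_add)
    have 2: "[int T * (int n + int d) = int n'] (mod int Q)"
      using swap(1) by (metis cong_int_iff of_nat_mult of_nat_add)
    have "[int T * int d = - 1 * int d'] (mod int Q)"
      using cong_diff[OF 2 1] by (simp add: algebra_simps)
    then have d: "d = d'" using dvd_cong_unit_mult_eq[OF c] dvd unfolding Q_def by blast
    \<comment> \<open>Now the term containing \<open>a\<close> becomes the leading one; its
      coefficient being 1 eliminates \<open>u\<close> and inverts \<open>a ^ P\<close>.\<close>
    have "a' = (u * v ^ (n * P) * a ^ P) * v ^ (d * P) * inverse (a ^ P)"
      using pos(3) unfolding swap(3)[symmetric] by (simp add: distrib_right power_add field_simps)
    then have "a' = inverse (a ^ P) * (v ^ P) ^ d"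
      unfolding swap(4) by (simp add: mult.commute flip: power_mult)
    then show thesis
      using that[of "int T" "v ^ P" i] d c 1 2 h(2) unfolding P_def Q_def by simp
  qed
qed

text \<open>This is the only place where the permutation property is needed: if \<open>r > 1\<close> divides
  \<open>n\<close>, \<open>d\<close> and \<open>q - 1\<close>, then \<open>X\<^sup>n(X\<^sup>d + a)\<close> factors through the non-injective map \<open>x \<mapsto> x\<^sup>r\<close>.\<close>

lemma normal_binom_inj_imp_coprime:
  fixes a :: "'a::finite_field"
  assumes "inj (normal_binom n d a)" "r dvd n" "r dvd d" "r dvd CARD('a) - 1"
  shows "r = 1"
proof (rule ccontr)
  assume "r \<noteq> 1"
  define Q where "Q = CARD('a) - 1"
  have Q: "Q > 0" using card_field_gt_1[where 'a='a] by (simp add: Q_def)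
  obtain m where m: "Q = r * m" using assms(4) unfolding Q_def by blast
  with Q \<open>r \<noteq> 1\<close> have r: "r > 1" "m > 0" by (cases r; simp)+
  have inj: "inj (\<lambda>x :: 'a. x ^ r)"
  proof (rule injI)
    fix x y :: 'a assume "x ^ r = y ^ r"
    then have "x ^ n = y ^ n" "x ^ d = y ^ d"
      using assms(2,3) by (auto elim!: dvdE simp: power_mult)
    then have "normal_binom n d a x = normal_binom n d a y" by (simp add: normal_binom_def)
    then show "x = y" using assms(1) by (simp add: inj_eq)
  qed
  then have surj: "surj (\<lambda>x :: 'a. x ^ r)" by (rule finite_UNIV_inj_surj[OF finite])
  \<comment> \<open>If x = y^r, then x^m = y^Q. So surjectivity yields x^(m + 1) = x everywhere,
    impossible for 0 < m < Q by uniqueness of exponents.\<close>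
  have root: "x ^ m * x = x" for x :: 'a
  proof -
    obtain y where y: "x = y ^ r" using surj by blast
    have "[Q + r = r] (mod CARD('a) - 1)" unfolding Q_def[symmetric] by (simp add: cong_def)
    then have "y ^ (Q + r) = y ^ r" using r by (intro field_power_cong) simp_all
    then show ?thesis by (simp add: y m power_add flip: power_mult)
  qed
  have "[Suc m = 1] (mod Q)"
  proof -
    \<comment> \<open>Zero terms pad the monomials so that the comparison of binomial coefficients
      applies.\<close>
    have "1 * x ^ Suc m + 0 * x ^ 1 = 1 * x ^ 1 + 0 * x ^ 1" for x :: 'a
      using root[of x] by (simp add: mult.commute)
    from binomial_fun_coeffs[OF this, of 1] show ?thesis
      unfolding Q_def by (simp split: if_splits)
  qed
  then have "Q dvd m" using cong_diff_nat[of "Suc m" 1 Q 1 1] by (simp add: cong_0_iff)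
  then have "Q \<le> m" using r by (simp add: dvd_imp_le)
  then show False using m r by simp
qed

subsection \<open>Cosets of \<open>d\<close>-th powers and their orbits\<close>

lemma pow_coset_eq_iff:
  fixes a b :: "'a::field"
  shows "pow_coset d a = pow_coset d b \<longleftrightarrow> (\<exists>w. w \<noteq> 0 \<and> b = a * w ^ d)"
proof
  assume "pow_coset d a = pow_coset d b"
  moreover have "b \<in> pow_coset d b" unfolding pow_coset_eq by (intro CollectI exI[of _ 1]) simp
  ultimately have "b \<in> pow_coset d a" by (rule ssubst)
  then show "\<exists>w. w \<noteq> 0 \<and> b = a * w ^ d" unfolding pow_coset_eq by blast
next
  assume "\<exists>w. w \<noteq> 0 \<and> b = a * w ^ d"
  then obtain w where w: "w \<noteq> 0" "b = a * w ^ d" by blast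
  have "a * x ^ d = b * (x / w) ^ d" "b * x ^ d = a * (w * x) ^ d" for x
    using w by (simp_all add: power_divide power_mult_distrib)
  moreover have "x / w \<noteq> 0" "w * x \<noteq> 0" if "x \<noteq> 0" for x using w that by simp_all
  ultimately show "pow_coset d a = pow_coset d b" unfolding pow_coset_eq by blast
qed

text \<open>Reducing the exponent modulo \<open>d\<close> changes the power by a d-th power. With
  integer exponents the residue of -1 acts as inversion.\<close>

lemma pow_coset_powi_mod:
  fixes a :: "'a::field"
  assumes "a \<noteq> 0"
  shows "pow_coset d (a powi (k mod int d)) = pow_coset d (a powi k)"
  unfolding pow_coset_eq_iff
proof (intro exI conjI)
  have "a powi k = a powi (k mod int d + (k div int d) * int d)" by simp
  also have "\<dots> = a powi (k mod int d) * (a powi (k div int d)) ^ d"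
    using assms by (simp only: power_int_add power_int_mult power_int_of_nat simp_thms)
  finally show "a powi k = a powi (k mod int d) * (a powi (k div int d)) ^ d" .
qed (use assms in simp)

lemma normal_binom_equiv_pow_coset:
  fixes a b :: "'a::finite_field"
  assumes "normal_binom n d a \<in> binomials" "pow_coset d a = pow_coset d b"
  shows "normal_binom n d a \<sim>\<^sub>b normal_binom n d b"
  using assms normal_binom_equiv_scale unfolding pow_coset_eq_iff by blast

section \<open>The group of residues acting on the coefficient\<close>

lemma CHAR_mod_in_units_mod:
  assumes "d dvd CARD('a::finite_field) - 1" "d > 0"
  shows "int CHAR('a) mod int d \<in> carrier (units_mod d)"
proof -
  have "coprime CHAR('a) d"
    using CHAR_coprime_card_minus_1[where 'a='a] assms(1) coprime_divisors dvd_refl by blast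
  then have "coprime (int CHAR('a)) (int d)" by simp
  then show ?thesis using assms(2) by (simp add: units_mod_def)
qed

lemma minus_1_mod_in_units_mod:
  assumes "d > 0"
  shows "(- 1) mod int d \<in> carrier (units_mod d)"
proof -
  have "coprime ((- 1) mod int d) (int d)"
    by (subst coprime_mod_left_iff) (use assms in simp_all)
  then show ?thesis using assms by (simp add: units_mod_def)
qed

definition G_generators :: "nat \<Rightarrow> nat \<Rightarrow> nat \<Rightarrow> nat \<Rightarrow> int set" where
  "G_generators p q d n =
    (if [int d = - 2 * int n] (mod int ((q - 1) div d)) \<and> gcd n (q - 1) = 1
     then {int p mod int d, (- 1) mod int d} else {int p mod int d})"

lemma carrier_G_grp:
  "carrier (G_grp p q d n) = generate (units_mod d) (G_generators p q d n)"
  by (simp add: G_grp_def G_generators_def)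

lemma G_generators_subset:
  assumes "d dvd CARD('a::finite_field) - 1" "d > 0"
  shows "G_generators CHAR('a) CARD('a) d n \<subseteq> carrier (units_mod d)"
  using CHAR_mod_in_units_mod[OF assms] minus_1_mod_in_units_mod[OF assms(2)]
  by (simp add: G_generators_def)

text \<open>\<open>coset_act\<close> raises to \<open>nat s\<close>, which is the integer power
  \<open>powi s\<close> for nonnegative \<open>s\<close>.\<close>

lemma G_grp_nonneg:
  assumes "d dvd CARD('a::finite_field) - 1" "d > 0" "g \<in> carrier (G_grp CHAR('a) CARD('a) d n)"
  shows "g \<ge> 0"
proof -
  interpret group "units_mod d" using assms(2) by (rule group_units_mod)
  have "g \<in> carrier (units_mod d)"
    using generate_in_carrier[OF G_generators_subset[OF assms(1,2)]] assms(3)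
    unfolding carrier_G_grp by blast
  then show ?thesis by (simp add: units_mod_def)
qed

text \<open>Induction over the generated subgroup: p acts by Frobenius, -1 by exchanging the
  monomials. The coefficient varies along the induction, hence \<open>bin\<close> for every nonzero
  one.\<close>

lemma normal_binom_equiv_G_grp:
  fixes a :: "'a::finite_field"
  assumes d: "d dvd CARD('a) - 1" "d > 0" and n: "n > 0"
    and bin: "\<And>b :: 'a. b \<noteq> 0 \<Longrightarrow> normal_binom n d b \<in> binomials"
    and g: "g \<in> carrier (G_grp CHAR('a) CARD('a) d n)" and a: "a \<noteq> 0"
  shows "normal_binom n d a \<sim>\<^sub>b normal_binom n d (a powi g)"
proof -
  interpret group "units_mod d" using d(2) by (rule group_units_mod)
  have coset: "normal_binom n d b \<sim>\<^sub>b normal_binom n d c"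
    if "b \<noteq> 0" "pow_coset d b = pow_coset d c" for b c :: 'a
    using normal_binom_equiv_pow_coset bin that by blast
  have gen: "normal_binom n d b \<sim>\<^sub>b normal_binom n d (b powi h)"
    if h: "h \<in> G_generators CHAR('a) CARD('a) d n" and b: "b \<noteq> 0" for h and b :: 'a
  proof -
    consider "h = int CHAR('a) mod int d"
      | "h = (- 1) mod int d" "[int d = - 2 * int n] (mod int ((CARD('a) - 1) div d))" "gcd n (CARD('a) - 1) = 1"
      using h unfolding G_generators_def by (meson empty_iff insert_iff)
    then obtain k where k: "h = k mod int d" "normal_binom n d b \<sim>\<^sub>b normal_binom n d (b powi k)"
    proof cases
      case 1
      then show ?thesis
        using that[of "int CHAR('a)"] normal_binom_equiv_power_CHAR[OF bin[OF b] n] by simp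
    next
      case 2
      then show ?thesis
        using that[of "- 1"] normal_binom_equiv_inverse[OF bin[OF b] b n d(1)] by simp
    qed
    moreover have "normal_binom n d (b powi k) \<sim>\<^sub>b normal_binom n d (b powi h)"
      using coset pow_coset_powi_mod[OF b, of d k] b by (simp add: k(1))
    ultimately show ?thesis using binom_equiv_trans by blast
  qed
  have "g \<in> generate (units_mod d) (G_generators CHAR('a) CARD('a) d n)"
    using g by (simp only: carrier_G_grp)
  then show ?thesis using a
  proof (induction g arbitrary: a rule: generate.induct)
    case one
    then show ?case
      using coset pow_coset_powi_mod[OF one, of d 1] by (simp add: units_mod_def)
  next
    case (incl h)
    then show ?case by (rule gen)
  next
    case (inv h)
    define g where "g = inv\<^bsub>units_mod d\<^esub> h"
    have "g \<otimes>\<^bsub>units_mod d\<^esub> h = \<one>\<^bsub>units_mod d\<^esub>"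
      unfolding g_def using G_generators_subset[OF d] inv(1) by (intro l_inv) blast
    then have gh: "(g * h) mod int d = 1 mod int d" by (simp add: units_mod_def)
    \<comment> \<open>The generator \<open>h\<close> leads from \<open>a powi g\<close> back to the
      coset of \<open>a\<close>; symmetry of the equivalence then handles the inverse.\<close>
    have "pow_coset d ((a powi g) powi h) = pow_coset d (a powi 1)"
      using pow_coset_powi_mod[OF inv(2), of d "g * h"] pow_coset_powi_mod[OF inv(2), of d 1]
      by (simp only: gh power_int_mult)
    then have "normal_binom n d ((a powi g) powi h) \<sim>\<^sub>b normal_binom n d a"
      using coset inv(2) by simp
    then have "normal_binom n d (a powi g) \<sim>\<^sub>b normal_binom n d a"
      using binom_equiv_trans gen[OF inv(1)] inv(2) by (metis power_int_eq_0_iff)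
    then show ?case unfolding g_def by (rule binom_equiv_sym)
  next
    case (eng h1 h2)
    have "h1 \<otimes>\<^bsub>units_mod d\<^esub> h2 = (h1 * h2) mod int d" by (simp add: units_mod_def)
    then have "pow_coset d ((a powi h1) powi h2) = pow_coset d (a powi (h1 \<otimes>\<^bsub>units_mod d\<^esub> h2))"
      using pow_coset_powi_mod[OF eng.prems, of d "h1 * h2"] by (simp only: power_int_mult)
    then have "normal_binom n d ((a powi h1) powi h2) \<sim>\<^sub>b normal_binom n d (a powi (h1 \<otimes>\<^bsub>units_mod d\<^esub> h2))"
      using coset eng.prems by simp
    moreover have "normal_binom n d (a powi h1) \<sim>\<^sub>b normal_binom n d ((a powi h1) powi h2)"
      using eng.IH(2) eng.prems by simp
    ultimately show ?case using eng.IH(1)[OF eng.prems] binom_equiv_trans by blast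
  qed
qed

lemma power_mod_in_G_grp:
  "int (p ^ i) mod int d \<in> carrier (G_grp p q d n)"
proof (induction i)
  case 0
  have "int (p ^ 0) mod int d = \<one>\<^bsub>units_mod d\<^esub>" by (simp add: units_mod_def)
  then show ?case unfolding carrier_G_grp by (simp only: generate.one)
next
  case (Suc i)
  have "int (p ^ Suc i) mod int d = (int p mod int d) \<otimes>\<^bsub>units_mod d\<^esub> (int (p ^ i) mod int d)"
    by (simp add: units_mod_def mod_mult_eq)
  moreover have "int p mod int d \<in> carrier (G_grp p q d n)"
    unfolding carrier_G_grp by (rule generate.incl) (simp add: G_generators_def)
  ultimately show ?case using Suc unfolding carrier_G_grp by (simp only: generate.eng)
qed

lemma minus_power_mod_in_G_grp:
  assumes "[int d = - 2 * int n] (mod int ((q - 1) div d))" "gcd n (q - 1) = 1"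
  shows "- int (p ^ i) mod int d \<in> carrier (G_grp p q d n)"
proof -
  have "- int (p ^ i) mod int d = ((- 1) mod int d) \<otimes>\<^bsub>units_mod d\<^esub> (int (p ^ i) mod int d)"
    by (simp add: units_mod_def mod_mult_eq)
  moreover have "(- 1) mod int d \<in> carrier (G_grp p q d n)"
    unfolding carrier_G_grp using assms by (intro generate.incl) (simp add: G_generators_def)
  ultimately show ?thesis
    using power_mod_in_G_grp unfolding carrier_G_grp by (simp only: generate.eng)
qed

lemma pow_coset_in_carrier:
  "a \<noteq> 0 \<Longrightarrow> pow_coset d a \<in> carrier (field_units Mod powers d)"
  by (auto simp: carrier_FactGroup pow_coset_def field_units_def)

lemma orbit_pow_coset:
  fixes a :: "'a::finite_field"
  assumes "a \<noteq> 0" "d dvd CARD('a) - 1" "d > 0"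
  shows "orbit (G_grp CHAR('a) CARD('a) d n) (coset_act d) (pow_coset d a)
    = {pow_coset d (a powi g) | g. g \<in> carrier (G_grp CHAR('a) CARD('a) d n)}"
proof -
  have "coset_act d g (pow_coset d a) = pow_coset d (a powi g)"
    if "g \<in> carrier (G_grp CHAR('a) CARD('a) d n)" for g
    using G_grp_nonneg[OF assms(2,3) that] coset_act_pow_coset[OF assms(1)]
    by (simp add: power_int_def)
  then show ?thesis unfolding orbit_def by force
qed

lemma orbit_reps_ex1:
  fixes a :: "'a::finite_field"
  assumes "orbit_reps d n A" "a \<noteq> 0"
  shows "\<exists>!C. C \<in> pow_coset d ` A \<and>
    C \<in> orbit (G_grp CHAR('a) CARD('a) d n) (coset_act d) (pow_coset d a)"
proof -
  have "orbit (G_grp CHAR('a) CARD('a) d n) (coset_act d) (pow_coset d a)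
      \<in> orbits (G_grp CHAR('a) CARD('a) d n) (carrier (field_units Mod powers d)) (coset_act d)"
    unfolding orbits_def using pow_coset_in_carrier[OF assms(2)] by blast
  with assms(1) show ?thesis unfolding orbit_reps_def by (elim conjE) (rule bspec)
qed

lemma orbit_reps_exists:
  fixes b :: "'a::finite_field"
  assumes "orbit_reps d n A" "b \<noteq> 0" "d dvd CARD('a) - 1" "d > 0"
  obtains a g where "a \<in> A" "g \<in> carrier (G_grp CHAR('a) CARD('a) d n)"
    "pow_coset d (b powi g) = pow_coset d a"
proof -
  obtain C where "C \<in> pow_coset d ` A" "C \<in> {pow_coset d (b powi g) | g. g \<in> carrier (G_grp CHAR('a) CARD('a) d n)}"
    using orbit_reps_ex1[OF assms(1,2)] unfolding orbit_pow_coset[OF assms(2-4)] by (elim ex1E conjE)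
  then obtain a g where "a \<in> A" "C = pow_coset d a" "C = pow_coset d (b powi g)"
    "g \<in> carrier (G_grp CHAR('a) CARD('a) d n)" by (elim imageE CollectE exE conjE)
  then show thesis using that[of a g] by simp
qed

text \<open>Both cosets lie in the orbit of the coset of \<open>a\<close>, so they coincide, and
  injectivity on \<open>A\<close> separates cosets.\<close>

lemma orbit_reps_unique:
  fixes a a' :: "'a::finite_field"
  assumes reps: "orbit_reps d n A" and a: "a \<in> A" "a' \<in> A"
    and d: "d dvd CARD('a) - 1" "d > 0"
    and g: "g \<in> carrier (G_grp CHAR('a) CARD('a) d n)" "pow_coset d (a powi g) = pow_coset d a'"
  shows "a = a'"
proof -
  let ?Orb = "orbit (G_grp CHAR('a) CARD('a) d n) (coset_act d) (pow_coset d a)"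
  have nz: "a \<noteq> 0" using reps a unfolding orbit_reps_def by blast
  note ex1 = orbit_reps_ex1[OF reps nz]
  have 1: "pow_coset d a' \<in> ?Orb"
    unfolding orbit_pow_coset[OF nz d] using g by (intro CollectI exI[of _ g]) simp
  have 2: "pow_coset d a \<in> ?Orb"
    unfolding orbit_pow_coset[OF nz d]
    using power_mod_in_G_grp[of "CHAR('a)" 0 d] pow_coset_powi_mod[OF nz, of d 1]
    by (intro CollectI exI[of _ "1 mod int d"]) simp
  have "pow_coset d a = pow_coset d a'"
    using the1_equality[OF ex1 conjI[OF imageI[OF a(1)] 2]] the1_equality[OF ex1 conjI[OF imageI[OF a(2)] 1]]
    by (rule trans[OF sym])
  moreover have "inj_on (pow_coset d) A" using reps by (simp add: orbit_reps_def)
  ultimately show ?thesis using a by (simp add: inj_on_eq_iff)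
qed

section \<open>Uniqueness and existence of the triple\<close>

lemma normal_binom_equiv_unique:
  fixes a a' :: "'a::finite_field"
  assumes reps: "orbit_reps d n (A d n)"
    and N: "n \<in> N_set CARD('a) d" "n' \<in> N_set CARD('a) d'"
    and a: "a \<in> A d n" "a' \<in> A d' n'" "a \<noteq> 0" "a' \<noteq> 0"
    and d: "d dvd CARD('a) - 1" "d' dvd CARD('a) - 1"
    and eq: "normal_binom n d a \<sim>\<^sub>b normal_binom n' d' a'"
    and inj: "inj (normal_binom n d a)"
  shows "(d, n, a) = (d', n', a')"
proof -
  have q: "CARD('a) > 1" by (rule card_field_gt_1)
  define Q where "Q = CARD('a) - 1"
  have Q: "Q > 0" using q by (simp add: Q_def)
  have dQ: "d dvd Q" using d by (simp add: Q_def)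
  have dpos: "d > 0" using dQ Q by (auto intro: Nat.gr0I)
  have npos: "n > 0" "n' > 0" using N by (auto simp: N_set_def)
  obtain t i w where dd: "d = d'" and t: "coprime t (int Q)" and w: "w \<noteq> 0"
    and *: "[t * int n = int n'] (mod int Q) \<and>
        [t * (int n + int d) = int n' + int d] (mod int Q) \<and> a' = a ^ CHAR('a) ^ i * w ^ d \<or>
     [t * int n = int n' + int d] (mod int Q) \<and>
        [t * (int n + int d) = int n'] (mod int Q) \<and> a' = inverse (a ^ CHAR('a) ^ i) * w ^ d"
    using normal_binom_equivD[OF eq npos a(3,4) d] unfolding Q_def by metis
  have "pair_rel Q d n n'" using t * unfolding pair_rel_def by blast
  then have nn: "n = n'"
    using N_set_unique[OF d(1) q N(1)] N(2) unfolding dd Q_def by blast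
  have "\<exists>g \<in> carrier (G_grp CHAR('a) CARD('a) d n). pow_coset d (a powi g) = pow_coset d a'"
    using *
  proof (elim disjE conjE)
    assume a': "a' = a ^ CHAR('a) ^ i * w ^ d"
    have "pow_coset d (a powi (int (CHAR('a) ^ i) mod int d)) = pow_coset d (a powi int (CHAR('a) ^ i))"
      by (rule pow_coset_powi_mod) fact
    also have "\<dots> = pow_coset d a'"
      unfolding pow_coset_eq_iff power_int_of_nat using w a' by blast
    finally show ?thesis using power_mod_in_G_grp by blast
  next
    assume 1: "[t * int n = int n' + int d] (mod int Q)" and 2: "[t * (int n + int d) = int n'] (mod int Q)"
      and a': "a' = inverse (a ^ CHAR('a) ^ i) * w ^ d"
    have "[t * int d = - 1 * int d] (mod int Q)"
      using cong_diff[OF 2 1] by (simp add: algebra_simps)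
    then have "[t = - 1] (mod int (Q div d))" using cong_quotient_iff[OF dQ Q] by blast
    \<comment> \<open>Combining this with t n \<equiv> n + d gives d \<equiv> -2n modulo
      \<open>Q div d\<close>, the first condition for -1 to be a generator.\<close>
    then have 3: "[t * int n = - 1 * int n] (mod int (Q div d))" by (intro cong_mult cong_refl)
    have "int (Q div d) dvd int Q" using dQ by (metis dvd_div_mult_self dvd_triv_left of_nat_dvd_iff)
    then have "[t * int n = int n + int d] (mod int (Q div d))"
      using 1 nn cong_dvd_mono_modulus by blast
    from cong_diff[OF cong_trans[OF cong_sym[OF this] 3] cong_refl[of "int n"]]
    have G1: "[int d = - 2 * int n] (mod int (Q div d))" by simp
    \<comment> \<open>Since t n \<equiv> n + d modulo \<open>Q\<close>, \<open>r\<close> also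
      divides \<open>d\<close>; injectivity then forces r = 1, the second condition.\<close>
    define r where "r = gcd n Q"
    have r: "int r dvd int n" "int r dvd int Q" by (simp_all add: r_def)
    have "int r dvd t * int n - (int n' + int d)"
      using 1 r(2) unfolding cong_iff_dvd_diff by (rule dvd_trans[rotated])
    then have "int r dvd int d"
      using r(1) unfolding nn[symmetric] by (simp add: dvd_diff_right_iff dvd_add_right_iff)
    then have "r = 1"
      using normal_binom_inj_imp_coprime[OF inj, of r] by (simp add: r_def Q_def)
    then have G: "[int d = - 2 * int n] (mod int ((CARD('a) - 1) div d))" "gcd n (CARD('a) - 1) = 1"
      using G1 unfolding r_def Q_def by blast+
    have "pow_coset d (a powi (- int (CHAR('a) ^ i) mod int d)) = pow_coset d (a powi - int (CHAR('a) ^ i))"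
      by (rule pow_coset_powi_mod) fact
    also have "\<dots> = pow_coset d a'"
      unfolding pow_coset_eq_iff power_int_minus power_int_of_nat using w a' by blast
    finally show ?thesis using minus_power_mod_in_G_grp[OF G] by blast
  qed
  then have "a = a'"
    using orbit_reps_unique[OF reps a(1) _ d(1) dpos] a(2) unfolding dd nn by blast
  then show ?thesis using dd nn by simp
qed

text \<open>A unit \<open>t\<close> takes m - k to its gcd \<open>d\<close> with \<open>Q\<close>;
  the exponents t k and t m then become \<open>n\<close> and \<open>n + d\<close>.\<close>

lemma binomial_equiv_normal_binom:
  fixes f :: "'a::finite_field \<Rightarrow> 'a"
  assumes "f \<in> binomials"
  obtains d n b where "d dvd CARD('a) - 1" "n \<in> {1..CARD('a) - 1}" "b \<noteq> 0" "f \<sim>\<^sub>b normal_binom n d b"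
proof -
  define Q where "Q = CARD('a) - 1"
  have Q: "Q > 0" using card_field_gt_1[where 'a='a] by (simp add: Q_def)
  obtain \<alpha> \<beta> m k where f: "f = (\<lambda>x. \<alpha> * x ^ m + \<beta> * x ^ k)"
    and nz: "\<alpha> \<noteq> 0" "\<beta> \<noteq> 0" "m > 0" "k > 0"
    using assms unfolding binomials_def by blast
  obtain t where t: "coprime t (int Q)" "[t * (int m - int k) = gcd (int m - int k) (int Q)] (mod int Q)"
    using exists_unit_mult_cong_gcd[of "int Q"] Q by auto
  define d where "d = nat (gcd (int m - int k) (int Q))"
  have d: "int d = gcd (int m - int k) (int Q)" by (simp add: d_def)
  have "int d dvd int Q" unfolding d by simp
  then have dQ: "d dvd Q" by simp
  \<comment> \<open>The shift by 1 selects the representative of t k in {1..Q}.\<close>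
  define n where "n = nat ((t * int k - 1) mod int Q) + 1"
  have n: "int n = (t * int k - 1) mod int Q + 1" using Q by (simp add: n_def)
  have "(t * int k - 1) mod int Q < int Q" using Q by simp
  then have "int n \<le> int Q" using n by linarith
  then have "n \<le> Q" by (simp only: of_nat_le_iff)
  then have n_in: "n \<in> {1..Q}" by (simp add: n_def)
  have tk: "[t * int k = int n] (mod int Q)"
    unfolding n cong_def by (simp add: mod_add_left_eq)
  have tm: "[t * int m = int n + int d] (mod int Q)"
    using cong_add[OF tk t(2)] by (simp add: algebra_simps d)
  have "f \<sim>\<^sub>b normal_binom n d (\<beta> / \<alpha>)"
    using binom_equiv_normal_binomI[OF assms, of \<alpha> m \<beta> k n t d] nz n_in t(1) tk tm
    unfolding Q_def f by simp
  moreover have "\<beta> / \<alpha> \<noteq> 0" using nz by simp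
  ultimately show thesis using that dQ n_in unfolding Q_def by blast
qed

text \<open>By coefficient comparison \<open>n + d\<close> and \<open>n\<close> are congruent to
  \<open>m\<close> and \<open>k\<close> in some order, so they inherit the incongruences. The
  coefficient can then move freely through cosets and orbits.\<close>

lemma normal_binom_in_binomials_any_coeff:
  fixes a b :: "'a::finite_field"
  assumes "normal_binom n d a \<in> binomials" "a \<noteq> 0" "b \<noteq> 0" "n > 0"
  shows "normal_binom n d b \<in> binomials"
proof -
  let ?Q = "CARD('a) - 1"
  obtain \<alpha> \<beta> m k where f: "normal_binom n d a = (\<lambda>x. \<alpha> * x ^ m + \<beta> * x ^ k)"
    and nz: "\<alpha> \<noteq> 0" "\<beta> \<noteq> 0" "m > 0" "k > 0"
    and nc: "\<not> [m = 0] (mod ?Q)" "\<not> [k = 0] (mod ?Q)" "\<not> [m = k] (mod ?Q)"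
    using assms(1) unfolding binomials_def by blast
  have eq: "\<alpha> * x ^ m + \<beta> * x ^ k = 1 * x ^ (n + d) + a * x ^ n" for x
    using fun_cong[OF f, of x] unfolding normal_binom_apply by simp
  have nd: "\<not> [n + d = n] (mod ?Q)" by (rule normal_binom_exponents_incong) fact+
  have "[m = n + d] (mod ?Q) \<and> [k = n] (mod ?Q) \<or> [m = n] (mod ?Q) \<and> [k = n + d] (mod ?Q)"
    using binomial_fun_eqD[OF eq nz(3,4) _ _ nz(1,2) nc(3) nd] assms(4) by blast
  then have "\<not> [n = 0] (mod ?Q)" "\<not> [n + d = 0] (mod ?Q)"
    using nc(1,2) cong_trans by blast+
  moreover have "normal_binom n d b = (\<lambda>x. 1 * x ^ (n + d) + b * x ^ n)"
    by (rule ext) (rule normal_binom_apply)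
  ultimately show ?thesis unfolding binomials_def using nd assms(3,4)
    by (intro CollectI exI[of _ 1] exI[of _ b] exI[of _ "n + d"] exI[of _ n]) simp
qed

theorem theorem2p2:
  fixes f :: "'a::finite_field \<Rightarrow> 'a"
    and A :: "nat \<Rightarrow> nat \<Rightarrow> 'a set"
  assumes "\<And>d n. d dvd CARD('a) - 1 \<Longrightarrow> n \<in> N_set CARD('a) d \<Longrightarrow> orbit_reps d n (A d n)"
    and "f \<in> binomials"
    and "bij f"
  shows "\<exists>!T. case T of (d, n, a) \<Rightarrow>
           d dvd CARD('a) - 1 \<and> n \<in> N_set CARD('a) d \<and> a \<in> A d n \<and>
           f \<sim>\<^sub>b (\<lambda>x. x ^ n * (x ^ d + a))"
  unfolding normal_binom_def[symmetric]
proof (rule ex_ex1I)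
  have q: "CARD('a) > 1" by (rule card_field_gt_1)
  \<comment> \<open>Existence: normalise the exponent difference, replace \<open>n0\<close> by its
    least representative, then move the coefficient along its orbit into
    \<open>A d n\<close>.\<close>
  obtain d n0 b0 where d: "d dvd CARD('a) - 1" and n0: "n0 \<in> {1..CARD('a) - 1}" and b0: "b0 \<noteq> 0"
    and f0: "f \<sim>\<^sub>b normal_binom n0 d b0"
    using binomial_equiv_normal_binom[OF assms(2)] by blast
  have dpos: "d > 0" using d q by (auto intro: Nat.gr0I)
  define n where "n = nstar CARD('a) d n0"
  have n: "n \<in> N_set CARD('a) d" unfolding n_def using d q n0 by (rule nstar_in_N_set)
  then have npos: "n > 0" by (simp add: N_set_def)
  have "pair_rel (CARD('a) - 1) d n0 n" unfolding n_def using d q n0 by (rule nstar_props)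
  then obtain b where b: "b \<noteq> 0" "normal_binom n0 d b0 \<sim>\<^sub>b normal_binom n d b"
    using normal_binom_equiv_pair_rel[OF binom_equiv_binomials(2)[OF f0] b0 _ npos] n0 by auto
  have bin: "normal_binom n d c \<in> binomials" if "c \<noteq> 0" for c :: 'a
    using normal_binom_in_binomials_any_coeff[OF binom_equiv_binomials(2)[OF b(2)] b(1) that npos] .
  obtain a g where a: "a \<in> A d n" and g: "g \<in> carrier (G_grp CHAR('a) CARD('a) d n)"
    and ag: "pow_coset d (b powi g) = pow_coset d a"
    using orbit_reps_exists[OF assms(1)[OF d n] b(1) d dpos] by blast
  have "normal_binom n d b \<sim>\<^sub>b normal_binom n d (b powi g)"
    using normal_binom_equiv_G_grp[OF d dpos npos bin g b(1)] .
  moreover have "normal_binom n d (b powi g) \<sim>\<^sub>b normal_binom n d a"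
    using normal_binom_equiv_pow_coset[OF bin ag] b(1) by simp
  ultimately have "f \<sim>\<^sub>b normal_binom n d a"
    using f0 b(2) binom_equiv_trans by blast
  with d n a show "\<exists>T. case T of (d, n, a) \<Rightarrow> d dvd CARD('a) - 1 \<and> n \<in> N_set CARD('a) d \<and> a \<in> A d n \<and>
      f \<sim>\<^sub>b normal_binom n d a"
    by (intro exI[of _ "(d, n, a)"]) simp
next
  fix T T' :: "nat \<times> nat \<times> 'a"
  obtain d n a d' n' a' where T: "T = (d, n, a)" "T' = (d', n', a')" by (cases T, cases T')
  assume "case T of (d, n, a) \<Rightarrow> d dvd CARD('a) - 1 \<and> n \<in> N_set CARD('a) d \<and> a \<in> A d n \<and>
      f \<sim>\<^sub>b normal_binom n d a"
  then have h: "d dvd CARD('a) - 1" "n \<in> N_set CARD('a) d" "a \<in> A d n" "f \<sim>\<^sub>b normal_binom n d a"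
    by (simp_all add: T)
  assume "case T' of (d, n, a) \<Rightarrow> d dvd CARD('a) - 1 \<and> n \<in> N_set CARD('a) d \<and> a \<in> A d n \<and>
      f \<sim>\<^sub>b normal_binom n d a"
  then have h': "d' dvd CARD('a) - 1" "n' \<in> N_set CARD('a) d'" "a' \<in> A d' n'" "f \<sim>\<^sub>b normal_binom n' d' a'"
    by (simp_all add: T)
  have "a \<noteq> 0" "a' \<noteq> 0"
    using assms(1)[OF h(1,2)] assms(1)[OF h'(1,2)] h(3) h'(3) unfolding orbit_reps_def by blast+
  moreover have "normal_binom n d a \<sim>\<^sub>b normal_binom n' d' a'"
    using binom_equiv_trans[OF binom_equiv_sym[OF h(4)] h'(4)] .
  \<comment> \<open>The permutation property of \<open>f\<close> supplies the coprimality used when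
    the monomials are exchanged.\<close>
  moreover have "inj (normal_binom n d a)"
    using binom_equiv_inj[OF h(4) bij_is_inj[OF assms(3)]] .
  ultimately show "T = T'"
    unfolding T using normal_binom_equiv_unique[of d n A] assms(1) h h' by blast
qed

end
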